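(* Let $R$ be an integral domain and let $\pi\neq0$ be a prime element of $R$. Let $n\ge 1$ and let $g_{(1)}(X),\dots,g_{(n)}(X)\in R[X]$ be monic polynomials of degree $\ge1$. Let $f(X)\in R[X]$ be a monic polynomial with discriminant $\Delta(f)\ne0$. Suppose that $$f(X)\equiv_{\pi\Delta(f)}\prod_{k\in[1,n]}g_{(k)}(X).$$ Then $\mathrm{Res}(g_{(1)},\dots,g_{(n)})\ne0$ and $$2\,\mathrm{v}_\pi\big(\mathrm{Res}(g_{(1)},\dots,g_{(n)})\big)\le \mathrm{v}_\pi(\Delta(f)).$$
   Context: Notation: $[a,b]=\{z\in\mathbb{Z}: a\le z\le b\}$. For $u\in R$ and $x,y\in R[X]$, $x\equiv_u y$ means $x-y\in uR[X]$. For $x\in R\setminus\{0\}$, $\mathrm{v}_\pi(x)=\max\{i\in\mathbb{Z}_{\ge0}:\pi^i\text{ divides }x\}$ (to be read as $+\infty$ if this set is unbounded), and $\mathrm{v}_\pi(0)=+\infty$. The discriminant of a monic polynomial with roots $\alpha_1,\dots,\alpha_m$ (with multiplicity) in a splitting field over the fraction field of $R$ is $\prod_{1\le i<j\le m}(\alpha_i-\alpha_j)^2\in R$. Generalised Sylvester matrix and resultant: let $g_{(1)},\dots,g_{(n)}\in R[X]$ be monic of degrees $m_{(k)}:=\deg g_{(k)}\ge1$. Put $M:=\sum_{j\in[1,n]}m_{(j)}$, $M_{(k)}:=M-m_{(k)}$ and write $\prod_{j\in[1,n]\setminus\{k\}}g_{(j)}(X)=\sum_{i\in[0,M_{(k)}]}a_{(k)i}X^i$.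 Then $\mathrm{Sylv}(g_{(1)},\dots,g_{(n)})\in R^{M\times M}$ is the matrix consisting of $n$ consecutive blocks of rows, the $k$-th block having $m_{(k)}$ rows; for $p\in[1,m_{(k)}]$, the $p$-th row of the $k$-th block has entry $a_{(k)\,q-p}$ in column $q$ if $p\le q\le p+M_{(k)}$ and entry $0$ in all other columns $q\in[1,M]$. The resultant is $\mathrm{Res}(g_{(1)},\dots,g_{(n)}):=\det\mathrm{Sylv}(g_{(1)},\dots,g_{(n)})\in R$. *)

theory Defs
  imports
    "HOL-Algebra.Algebraic_Closure_Type"
    "Jordan_Normal_Form.Char_Poly"
    "HOL-Computational_Algebra.Polynomial_Factorial"
    "HOL-Library.Extended_Nat"
begin

text \<open>The supremum in \<^typ>\<open>enat\<close> is \<open>\<infinity>\<close> when \<open>\<pi>\<close> divides \<open>x\<close> to arbitrarily high powers; this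
  includes \<open>x = 0\<close>, and in a non-noetherian domain it can also happen for \<open>x \<noteq> 0\<close>.\<close>

definition valuation :: "'a::idom \<Rightarrow> 'a \<Rightarrow> enat" where
  "valuation \<pi> x = (SUP i\<in>{i. \<pi> ^ i dvd x}. enat i)"

abbreviation to_frac_ac :: "'a::idom \<Rightarrow> 'a fract alg_closure" where
  "to_frac_ac x \<equiv> to_ac (to_fract x)"

text \<open>For monic \<open>f\<close> over a domain, the product of the squared root differences, formed in an
  algebraic closure of the fraction field, lies in the image of the domain; \<open>discriminant f\<close> is its
  unique preimage (see \<open>to_frac_ac_discriminant\<close> below). The value is only meaningful for monic
  \<open>f\<close>. Roots are listed with multiplicity.\<close>

definition discriminant :: "'a::idom poly \<Rightarrow> 'a" where
  "discriminant f = (THE d. \<exists>as.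
     map_poly to_frac_ac f = (\<Prod>a\<leftarrow>as. [:- a, 1:]) \<and>
     to_frac_ac d = (\<Prod>j<length as. \<Prod>i<j. (as ! i - as ! j) ^ 2))"

lemma to_frac_ac_hom: "inj_idom_hom (to_frac_ac :: 'a::idom \<Rightarrow> _)"
  by unfold_locales auto

fun disc_list :: "'a::idom list \<Rightarrow> 'a" where
  "disc_list [] = 1"
| "disc_list (a # as) = (\<Prod>b\<leftarrow>as. (a - b) ^ 2) * disc_list as"

lemma disc_list_middle:
  "disc_list (ys @ a # zs) = (\<Prod>b\<leftarrow>ys @ zs. (a - b) ^ 2) * disc_list (ys @ zs)"
  by (induction ys) (auto simp: power2_commute mult_ac)

lemma disc_list_mset_cong:
  "mset as = mset bs \<Longrightarrow> disc_list as = disc_list bs"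
proof (induction as arbitrary: bs)
  case (Cons a as)
  then have "a \<in> set bs" by (metis list.set_intros(1) set_mset_mset)
  then obtain ys zs where bs: "bs = ys @ a # zs" by (meson split_list)
  with Cons.prems have m: "mset as = mset (ys @ zs)" by simp
  have "mset (map (\<lambda>b. (a - b) ^ 2) as) = mset (map (\<lambda>b. (a - b) ^ 2) (ys @ zs))"
    using m by (simp only: mset_map)
  then have "(\<Prod>b\<leftarrow>as. (a - b) ^ 2) = (\<Prod>b\<leftarrow>ys @ zs. (a - b) ^ 2)"
    by (metis prod_mset_prod_list)
  with Cons.IH[OF m] show ?case by (simp only: bs disc_list_middle disc_list.simps)
qed simp

lemma disc_list_nth:
  "disc_list as = (\<Prod>j<length as. \<Prod>i<j. (as ! i - as ! j) ^ 2)"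
proof (induction as)
  case (Cons a as)
  have "(\<Prod>j<length (a # as). \<Prod>i<j. ((a # as) ! i - (a # as) ! j) ^ 2)
      = (\<Prod>j<length as. (a - as ! j) ^ 2 * (\<Prod>i<j. (as ! i - as ! j) ^ 2))"
    by (simp add: prod.lessThan_Suc_shift del: prod.lessThan_Suc)
  also have "\<dots> = (\<Prod>j<length as. (a - as ! j) ^ 2) * disc_list as"
    by (simp only: prod.distrib Cons.IH)
  also have "(\<Prod>j<length as. (a - as ! j) ^ 2) = (\<Prod>b\<leftarrow>as. (a - b) ^ 2)"
    by (simp add: prod.list_conv_set_nth atLeast0LessThan)
  finally show ?case by simp
qed simp

lemma disc_list_eq_0:
  "\<not> distinct as \<Longrightarrow> disc_list as = 0"
  by (induction as) (auto simp: image_iff)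

lemma prod_pderiv_roots:
  fixes as :: "'a::idom list"
  shows "\<exists>s\<in>{1,-1}. (\<Prod>a\<leftarrow>as. poly (pderiv (\<Prod>b\<leftarrow>as. [:- b, 1:])) a) = s * disc_list as"
proof (induction as)
  case (Cons a as)
  define P where "P = (\<Prod>b\<leftarrow>as. [:- b, 1:])"
  have F: "poly (pderiv ([:- a, 1:] * P)) x = poly P x + (x - a) * poly (pderiv P) x" for x
    by (subst pderiv_mult) (simp add: pderiv_pCons algebra_simps)
  have P: "poly P x = (\<Prod>b\<leftarrow>as. x - b)" for x
    unfolding P_def by (induction as) (auto simp: algebra_simps)
  have 0: "poly P b = 0" if "b \<in> set as" for b
    using that by (auto simp: P prod_list_zero_iff)
  have 1: "map (\<lambda>b. poly (pderiv ([:- a, 1:] * P)) b) as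
      = map (\<lambda>b. (b - a) * poly (pderiv P) b) as"
    by (rule map_cong[OF refl]) (simp only: F 0 add_0_left)
  from Cons obtain s where s: "s \<in> {1,-1}" "(\<Prod>b\<leftarrow>as. poly (pderiv P) b) = s * disc_list as"
    unfolding P_def by blast
  have mult: "(\<Prod>b\<leftarrow>xs. u b * v b) = (\<Prod>b\<leftarrow>xs. u b) * (\<Prod>b\<leftarrow>xs. v b)"
    for u v :: "'a \<Rightarrow> 'a" and xs
    by (induction xs) (auto simp: mult_ac)
  have 2: "(\<Prod>b\<leftarrow>as. a - b) * (\<Prod>b\<leftarrow>as. b - a) = (-1) ^ length as * (\<Prod>b\<leftarrow>as. (a - b) ^ 2)"
    by (induction as) (auto simp: power2_eq_square algebra_simps)
  have "(\<Prod>b\<leftarrow>a # as. poly (pderiv (\<Prod>b\<leftarrow>a # as. [:- b, 1:])) b)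
     = poly (pderiv ([:- a, 1:] * P)) a * (\<Prod>b\<leftarrow>as. poly (pderiv ([:- a, 1:] * P)) b)"
    by (simp only: list.map prod_list.Cons P_def)
  also have "(\<Prod>b\<leftarrow>as. poly (pderiv ([:- a, 1:] * P)) b) = (\<Prod>b\<leftarrow>as. b - a) * (\<Prod>b\<leftarrow>as. poly (pderiv P) b)"
    by (rule trans[OF arg_cong[OF 1, of prod_list] mult])
  also have "poly (pderiv ([:- a, 1:] * P)) a * \<dots> = (\<Prod>b\<leftarrow>as. a - b) * ((\<Prod>b\<leftarrow>as. b - a) * (\<Prod>b\<leftarrow>as. poly (pderiv P) b))"
    by (simp only: F P) simp
  also have "\<dots> = ((-1) ^ length as * s) * disc_list (a # as)"
    using 2 s(2) by (simp add: mult_ac)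
  finally show ?case using s(1)
    by (intro bexI[of _ "(-1) ^ length as * s"]) (auto simp: uminus_power_if)
qed simp

lemma prod_poly_roots_in_range:
  fixes f g :: "'a::idom poly"
  assumes f: "lead_coeff f = 1"
    and fac: "map_poly to_frac_ac f = (\<Prod>a\<leftarrow>as. [:- a, 1:])"
    and dist: "distinct as"
  shows "\<exists>d. to_frac_ac d = (\<Prod>a\<leftarrow>as. poly (map_poly to_frac_ac g) a)"
proof -
  interpret h: inj_idom_hom "to_frac_ac :: 'a \<Rightarrow> _" by (rule to_frac_ac_hom)
  interpret hp: map_poly_inj_idom_hom "to_frac_ac :: 'a \<Rightarrow> _" ..
  let ?h = "to_frac_ac :: 'a \<Rightarrow> _"
  define m where "m = length as"
  have deg: "degree f = m"
    using arg_cong[OF fac, of degree] degree_linear_factors[of uminus as] by (simp add: m_def)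
  have f0: "f \<noteq> 0" using f by auto
  have root: "poly (map_poly ?h f) (as ! i) = 0" if "i < m" for i
    using that unfolding fac by (auto simp: m_def poly_prod_list prod_list_zero_iff intro!: rev_image_eqI[of "as ! i"])
  define r where "r k = snd (pseudo_divmod (monom 1 k * g) f)" for k
  have r: "r k = 0 \<or> degree (r k) < m"
    and r_eval: "i < m \<Longrightarrow> poly (map_poly ?h (r k)) (as ! i) = (as ! i) ^ k * poly (map_poly ?h g) (as ! i)" for k i
  proof -
    obtain q where q: "pseudo_divmod (monom 1 k * g) f = (q, r k)"
      unfolding r_def by (metis prod.collapse)
    note * = pseudo_divmod[OF f0 q]
    show "r k = 0 \<or> degree (r k) < m" using *(2) deg by simp
    have "monom 1 k * g = f * q + r k" using *(1) f by simp
    then have "map_poly ?h (monom 1 k) * map_poly ?h g = map_poly ?h f * map_poly ?h q + map_poly ?h (r k)"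
      by (metis hp.hom_add hp.hom_mult)
    then have "poly (map_poly ?h (monom 1 k) * map_poly ?h g) (as ! i)
       = poly (map_poly ?h f * map_poly ?h q + map_poly ?h (r k)) (as ! i)" by simp
    then show "poly (map_poly ?h (r k)) (as ! i) = (as ! i) ^ k * poly (map_poly ?h g) (as ! i)" if "i < m"
      using root[OF that] by (simp add: poly_monom)
  qed
  define G where "G = mat m m (\<lambda>(k,j). coeff (r k) j)"
  define V where "V = mat m m (\<lambda>(j,i). (as ! i) ^ j)"
  define E where "E = mat m m (\<lambda>(i,j). if i = j then poly (map_poly ?h g) (as ! i) else 0)"
  have c: "G \<in> carrier_mat m m" "V \<in> carrier_mat m m" "E \<in> carrier_mat m m"
    by (auto simp: G_def V_def E_def)
  have poly_sum: "poly p x = (\<Sum>j<m. coeff p j * x ^ j)" if "p = 0 \<or> degree p < m"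
    for p :: "'a fract alg_closure poly" and x
  proof (cases "p = 0")
    case False
    with that have "{..degree p} \<subseteq> {..<m}" by auto
    then show ?thesis unfolding poly_altdef
      by (intro sum.mono_neutral_left) (auto simp: coeff_eq_0)
  qed simp
  have "map_mat ?h G * V = V * E"
  proof (rule eq_matI)
    fix k i assume "k < dim_row (V * E)" "i < dim_col (V * E)"
    then have ki: "k < m" "i < m" by (auto simp: V_def E_def)
    have "(map_mat ?h G * V) $$ (k,i) = (\<Sum>j<m. ?h (coeff (r k) j) * (as ! i) ^ j)"
      using ki by (auto simp: G_def V_def scalar_prod_def atLeast0LessThan)
    also have "\<dots> = poly (map_poly ?h (r k)) (as ! i)"
      using r[of k] by (subst poly_sum) auto
    also have "\<dots> = (as ! i) ^ k * poly (map_poly ?h g) (as ! i)" using r_eval ki by simp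
    also have "\<dots> = (\<Sum>j<m. if j = i then (as ! j) ^ k * poly (map_poly ?h g) (as ! i) else 0)"
      using ki by simp
    also have "\<dots> = (V * E) $$ (k,i)"
      using ki by (auto simp: V_def E_def scalar_prod_def atLeast0LessThan if_distrib[of "(*) _"] cong: if_cong)
    finally show "(map_mat ?h G * V) $$ (k,i) = (V * E) $$ (k,i)" .
  qed (auto simp: G_def V_def E_def)
  then have "det (map_mat ?h G * V) = det (V * E)" by simp
  then have eq: "?h (det G) * det V = det V * det E"
    using c by (simp add: det_mult[of _ m] )
  have "det (transpose_mat V) \<noteq> 0"
  proof
    assume "det (transpose_mat V) = 0"
    then obtain v where v: "v \<in> carrier_vec m" "v \<noteq> 0\<^sub>v m" "transpose_mat V *\<^sub>v v = 0\<^sub>v m"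
      using c by (subst (asm) det_0_iff_vec_prod_zero[of _ m]) auto
    define p where "p = (\<Sum>j<m. monom (v $ j) j)"
    have cp: "coeff p j = (if j < m then v $ j else 0)" for j
      by (simp add: p_def coeff_sum)
    have "degree p \<le> m - 1" by (rule degree_le) (auto simp: cp)
    have p0: "p \<noteq> 0"
    proof
      assume "p = 0"
      then have "v = 0\<^sub>v m" using v(1) cp by (intro eq_vecI) (auto, metis coeff_0)
      with v(2) show False by simp
    qed
    then have m0: "m \<noteq> 0" by (auto simp: p_def intro: gr0I)
    have "poly p (as ! i) = 0" if "i < m" for i
    proof -
      have "poly p (as ! i) = (\<Sum>j<m. v $ j * (as ! i) ^ j)"
        by (simp add: p_def poly_sum poly_monom Polynomial.poly_sum)
      also have "\<dots> = (transpose_mat V *\<^sub>v v) $ i"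
        using that v(1) by (auto simp: V_def scalar_prod_def atLeast0LessThan mult.commute)
      also have "\<dots> = 0" using that v(3) by simp
      finally show ?thesis .
    qed
    then have "set as \<subseteq> {x. poly p x = 0}" by (auto simp: in_set_conv_nth m_def)
    then have "card (set as) \<le> card {x. poly p x = 0}"
      using p0 by (intro card_mono poly_roots_finite)
    also have "\<dots> \<le> degree p" using p0 by (rule card_poly_roots_bound)
    finally have "m \<le> degree p" using dist by (simp add: distinct_card m_def)
    with \<open>degree p \<le> m - 1\<close> m0 show False by linarith
  qed
  then have "det V \<noteq> 0" using det_transpose[OF c(2)] by simp
  with eq have "?h (det G) = det E" by (simp add: mult.commute)
  also have "det E = prod_list (diag_mat E)"
    by (rule det_upper_triangular[OF _ c(3)]) (auto simp: E_def)
  also have "diag_mat E = map (\<lambda>i. poly (map_poly ?h g) (as ! i)) [0..<m]"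
    by (auto simp: diag_mat_def E_def)
  also have "\<dots> = map (poly (map_poly ?h g)) as"
    by (rule nth_equalityI) (auto simp: m_def)
  finally show ?thesis by blast
qed

lemma to_frac_ac_discriminant:
  fixes f :: "'a::idom poly"
  assumes f: "lead_coeff f = 1"
    and fac: "map_poly to_frac_ac f = (\<Prod>a\<leftarrow>as. [:- a, 1:])"
  shows "to_frac_ac (discriminant f) = (\<Prod>j<length as. \<Prod>i<j. (as ! i - as ! j) ^ 2)"
proof -
  interpret h: inj_idom_hom "to_frac_ac :: 'a \<Rightarrow> _" by (rule to_frac_ac_hom)
  have unique: "disc_list bs = disc_list as"
    if "map_poly to_frac_ac f = (\<Prod>a\<leftarrow>bs. [:- a, 1:])" for bs
  proof (rule disc_list_mset_cong)
    have *: "proots (\<Prod>a\<leftarrow>cs. [:- a, 1:]) = mset cs" for cs :: "'a fract alg_closure list"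
      
    proof (induction cs)
      case (Cons c cs)
      have "(\<Prod>a\<leftarrow>cs. [:- a, 1:]) \<noteq> 0" by (auto simp: prod_list_zero_iff)
      with Cons show ?case by (simp add: proots_mult del: mult_pCons_left)
    qed simp
    show "mset bs = mset as" by (metis * fac that)
  qed
  have "\<exists>d. to_frac_ac d = disc_list as"
  proof (cases "distinct as")
    case False
    then show ?thesis by (intro exI[of _ 0]) (simp add: disc_list_eq_0)
  next
    case True
    obtain d where d: "to_frac_ac d = (\<Prod>a\<leftarrow>as. poly (map_poly to_frac_ac (pderiv f)) a)"
      using prod_poly_roots_in_range[OF f fac True] by blast
    obtain s where s: "s \<in> {1,-1}" "to_frac_ac d = s * disc_list as"
      using prod_pderiv_roots[of as] unfolding d h.map_poly_pderiv fac by blast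
    then have "to_frac_ac d = disc_list as \<or> to_frac_ac (- d) = disc_list as" by auto
    then show ?thesis by blast
  qed
  then obtain d where d: "to_frac_ac d = disc_list as" by blast
  have "discriminant f = d"
    unfolding discriminant_def disc_list_nth[symmetric]
  proof (rule the_equality)
    show "\<exists>as. map_poly to_frac_ac f = (\<Prod>a\<leftarrow>as. [:- a, 1:]) \<and> to_frac_ac d = disc_list as"
      using fac d by blast
    fix d' assume "\<exists>as. map_poly to_frac_ac f = (\<Prod>a\<leftarrow>as. [:- a, 1:]) \<and> to_frac_ac d' = disc_list as"
    then have "to_frac_ac d' = to_frac_ac d" using unique d by auto
    then show "d' = d" by simp
  qed
  with d show ?thesis by (simp add: disc_list_nth)
qed

lemma discriminant_roots_exist:
  fixes f :: "'a::idom poly"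
  assumes "lead_coeff f = 1"
  obtains as where "map_poly to_frac_ac f = (\<Prod>a\<leftarrow>as. [:- a, 1:])"
proof -
  interpret h: inj_idom_hom "to_frac_ac :: 'a \<Rightarrow> _" by (rule to_frac_ac_hom)
  let ?F = "map_poly to_frac_ac f"
  have lc: "lead_coeff ?F = 1" using assms by simp
  then have "?F \<noteq> 0" by auto
  then obtain A where A: "?F = smult (lead_coeff ?F) (\<Prod>x\<in>#A. [:- x, 1:])"
    using alg_closed_imp_factorization by blast
  obtain as where "A = mset as" using ex_mset by metis
  with A lc have "?F = (\<Prod>a\<leftarrow>as. [:- a, 1:])"
    by (simp only: smult_1_left flip: prod_mset_prod_list mset_map)
  then show thesis by (rule that)
qed

text \<open>The polynomials are \<open>g 1, \<dots>, g n\<close>. The \<open>k\<close>-th block of rows consists of the coefficient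
  vectors (constant term first) of \<open>X ^ p * (\<Prod>j\<in>{1..n} - {k}. g j)\<close> for \<open>p < degree (g k)\<close>. Rows and
  columns are counted from \<open>0\<close>. For monic \<open>g j\<close>, the product has degree \<open>M - degree (g k)\<close>.\<close>

definition sylvester_row :: "nat \<Rightarrow> 'a::comm_ring_1 poly \<Rightarrow> nat \<Rightarrow> 'a vec" where
  "sylvester_row M h p = vec M (\<lambda>q. if p \<le> q \<and> q \<le> p + degree h then coeff h (q - p) else 0)"

definition Sylv :: "nat \<Rightarrow> (nat \<Rightarrow> 'a::comm_ring_1 poly) \<Rightarrow> 'a mat" where
  "Sylv n g = (let M = (\<Sum>k=1..n. degree (g k)) in
     mat_of_rows M (concat (map
       (\<lambda>k. map (sylvester_row M (\<Prod>j\<in>{1..n} - {k}. g j)) [0..<degree (g k)])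
       [1..<Suc n])))"

lemma Sylv_carrier:
  "Sylv n g \<in> carrier_mat (\<Sum>k=1..n. degree (g k)) (\<Sum>k=1..n. degree (g k))"
proof -
  have "sum_list (map (\<lambda>k. degree (g k)) [1..<Suc n]) = (\<Sum>k=1..n. degree (g k))"
    by (simp only: interv_sum_list_conv_sum_set_nat atLeastLessThanSuc_atLeastAtMost set_upt)
  then show ?thesis
    unfolding Sylv_def Let_def by (simp add: length_concat o_def mat_of_rows_def del: upt_Suc)
qed

definition Res :: "nat \<Rightarrow> (nat \<Rightarrow> 'a::comm_ring_1 poly) \<Rightarrow> 'a" where
  "Res n g = det (Sylv n g)"

end

theory Submission
  imports Defs
begin

text \<open>Put \<open>G = (\<Prod>k. g k)\<close>. In terms of roots,
  \<open>\<Delta>(G) = Res(g 1, \<dots>, g n)\<^sup>2 * (\<Prod>k. \<Delta>(g k))\<close>. Up to sign, the discriminant is the resultant of a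
  polynomial and its derivative, hence a determinant that is polynomial in the coefficients; so
  \<open>\<Delta>(G) \<equiv> \<plusminus> \<Delta>(f)\<close> modulo \<open>\<pi> \<Delta>(f)\<close>, that is, \<open>\<Delta>(G) = \<Delta>(f) * w\<close> with \<open>w \<equiv> \<plusminus> 1\<close> modulo \<open>\<pi>\<close>. Therefore
  every power of \<open>\<pi>\<close> dividing \<open>Res\<^sup>2\<close> divides \<open>\<Delta>(f)\<close>. Both determinants are evaluated
  over an algebraic closure by passing to Newton bases \<open>\<Prod>i<r. X - b i\<close> on the roots, with respect
  to which the matrices become triangular; this also covers multiple roots.\<close>

section \<open>Newton polynomials and expansions in the Newton basis\<close>

definition newton_poly :: "(nat \<Rightarrow> 'a::idom) \<Rightarrow> nat \<Rightarrow> 'a poly" where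
  "newton_poly b r = (\<Prod>i<r. [:- b i, 1:])"

lemma newton_poly_Suc: "newton_poly b (Suc r) = newton_poly b r * [:- b r, 1:]"
  by (simp add: newton_poly_def)

lemma monic_newton_poly: "lead_coeff (newton_poly b r) = 1"
  by (simp add: newton_poly_def lead_coeff_prod)

lemma newton_poly_nonzero: "newton_poly b r \<noteq> 0"
  using monic_newton_poly[of b r] by auto

lemma degree_newton_poly: "degree (newton_poly b r) = r"
  by (simp add: newton_poly_def degree_prod_eq_sum_degree)

text \<open>Repeated synthetic division of \<open>c\<close> by \<open>X - b r\<close>,
  \<open>X - b (r + 1)\<close> and so on: the remainders are the coefficients \<open>u s\<close>,
  the last quotient is \<open>q\<close>, and the first remainder is the value of \<open>c\<close> at
  \<open>b r\<close>.\<close>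

lemma newton_expansion:
  assumes "r \<le> M"
  shows "\<exists>u q. newton_poly b r * c = (\<Sum>s\<in>{r..<M}. smult (u s) (newton_poly b s)) + newton_poly b M * q
           \<and> (r < M \<longrightarrow> u r = poly c (b r))"
  using assms
proof (induction r arbitrary: c rule: inc_induct)
  case base
  show ?case by (rule exI[of _ "\<lambda>_. 0"], rule exI[of _ c]) simp
next
  case (step r)
  define c' where "c' = synthetic_div c (b r)"
  from step.IH[of c'] obtain u q where
    u: "newton_poly b (Suc r) * c' = (\<Sum>s\<in>{Suc r..<M}. smult (u s) (newton_poly b s)) + newton_poly b M * q"
    by blast
  have c: "c = [:- b r, 1:] * c' + [:poly c (b r):]"
    unfolding c'_def by (rule synthetic_div_correct'[symmetric])
  let ?u = "u(r := poly c (b r))"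
  have "newton_poly b r * c = newton_poly b (Suc r) * c' + smult (poly c (b r)) (newton_poly b r)"
    proof -
    have "newton_poly b r * [:poly c (b r):] = smult (poly c (b r)) (newton_poly b r)" by simp
    then show ?thesis unfolding newton_poly_Suc by (subst c) (simp only: distrib_left mult.assoc)
  qed
  also have "\<dots> = (\<Sum>s\<in>{r..<M}. smult (?u s) (newton_poly b s)) + newton_poly b M * q"
  proof -
    have "(\<Sum>s\<in>{Suc r..<M}. smult (?u s) (newton_poly b s)) = (\<Sum>s\<in>{Suc r..<M}. smult (u s) (newton_poly b s))"
      by (rule sum.cong) auto
    then show ?thesis using step.hyps(2) unfolding u
      by (subst (2) sum.atLeast_Suc_lessThan) auto
  qed
  finally show ?case by (intro exI[of _ ?u] exI[of _ q]) auto
qed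

text \<open>The quotient \<open>q\<close> vanishes: a nonzero multiple of
  \<open>newton_poly b M\<close> has degree at least \<open>M\<close>.\<close>

lemma newton_expansion_degree_less:
  assumes r: "r < M" and deg: "degree (newton_poly b r * c) < M"
  obtains u where "newton_poly b r * c = (\<Sum>s<M. smult (u s) (newton_poly b s))"
    "u r = poly c (b r)" "\<And>s. s < r \<Longrightarrow> u s = 0"
proof -
  obtain u q where u: "newton_poly b r * c = (\<Sum>s\<in>{r..<M}. smult (u s) (newton_poly b s)) + newton_poly b M * q"
      "u r = poly c (b r)"
    using newton_expansion[of r M b c] r by auto
  have "degree (\<Sum>s\<in>{r..<M}. smult (u s) (newton_poly b s)) < M"
    using r by (intro degree_sum_less) (auto simp: degree_newton_poly intro!: le_less_trans[OF degree_smult_le])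
  then have "degree (newton_poly b M * q) < M"
    using deg u(1) by (metis add_diff_cancel_left' degree_diff_less)
  then have q: "q = 0"
    by (cases "q = 0") (auto simp: degree_mult_eq newton_poly_nonzero degree_newton_poly)
  let ?u = "\<lambda>s. if s < r then 0 else u s"
  have "(\<Sum>s<M. smult (?u s) (newton_poly b s)) = (\<Sum>s\<in>{r..<M}. smult (u s) (newton_poly b s))"
    by (rule sum.mono_neutral_cong_right) auto
  with u q show thesis by (intro that[of ?u]) auto
qed

section \<open>Determinants of matrices whose rows are polynomials\<close>

definition coeff_mat :: "nat \<Rightarrow> (nat \<Rightarrow> 'a::zero poly) \<Rightarrow> 'a mat" where
  "coeff_mat M S = mat M M (\<lambda>(r, q). coeff (S r) q)"

lemma coeff_mat_carrier [simp]: "coeff_mat M S \<in> carrier_mat M M"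
  by (simp add: coeff_mat_def)

lemma mat_mult_coeff_mat:
  "mat M M (\<lambda>(r, s). t r s) * coeff_mat M S = coeff_mat M (\<lambda>r. \<Sum>s<M. smult (t r s) (S s))"
  by (rule eq_matI) (auto simp: coeff_mat_def scalar_prod_def coeff_sum atLeast0LessThan)

lemma prod_list_diag_mat: "prod_list (diag_mat (mat M M (\<lambda>(r, s). t r s))) = (\<Prod>r<M. t r r)"
proof -
  have "diag_mat (mat M M (\<lambda>(r, s). t r s)) = map (\<lambda>r. t r r) [0..<M]"
    by (auto simp: diag_mat_def)
  then show ?thesis by (simp add: prod.distinct_set_conv_list[symmetric] atLeast0LessThan)
qed

text \<open>With respect to the Newton basis of the target, rows that are multiples of the Newton
  polynomials form an upper triangular matrix.\<close>

lemma det_coeff_mat_newton: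
  fixes b :: "nat \<Rightarrow> 'a::idom"
  assumes deg: "\<And>r. r < M \<Longrightarrow> degree (newton_poly b r * c r) < M"
  shows "det (coeff_mat M (\<lambda>r. newton_poly b r * c r)) = (\<Prod>r<M. poly (c r) (b r))"
proof -
  have "\<forall>r. \<exists>u. r < M \<longrightarrow> newton_poly b r * c r = (\<Sum>s<M. smult (u s) (newton_poly b s)) \<and>
      u r = poly (c r) (b r) \<and> (\<forall>s<r. u s = 0)"
    using newton_expansion_degree_less[OF _ deg] by metis
  then obtain u where u: "\<And>r. r < M \<Longrightarrow> newton_poly b r * c r = (\<Sum>s<M. smult (u r s) (newton_poly b s))"
      "\<And>r. r < M \<Longrightarrow> u r r = poly (c r) (b r)" "\<And>r s. r < M \<Longrightarrow> s < r \<Longrightarrow> u r s = 0"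
    by metis
  \<comment> \<open>Upper triangular coordinates times the Newton basis itself; the latter is lower
    triangular with unit diagonal, as \<open>newton_poly b s\<close> is monic of degree
    \<open>s\<close>.\<close>
  have "coeff_mat M (\<lambda>r. newton_poly b r * c r) = mat M M (\<lambda>(r, s). u r s) * coeff_mat M (newton_poly b)"
    unfolding mat_mult_coeff_mat by (rule eq_matI) (auto simp: coeff_mat_def u(1))
  then have "det (coeff_mat M (\<lambda>r. newton_poly b r * c r))
      = det (mat M M (\<lambda>(r, s). u r s)) * det (coeff_mat M (newton_poly b))"
    by (simp add: det_mult[of _ M])
  also have "det (mat M M (\<lambda>(r, s). u r s)) = (\<Prod>r<M. poly (c r) (b r))"
    by (subst det_upper_triangular[of _ M]) (auto simp: prod_list_diag_mat u)
  also have "det (coeff_mat M (newton_poly b)) = 1"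
  proof -
    have "det (coeff_mat M (newton_poly b)) = (\<Prod>r<M. coeff (newton_poly b r) r)"
      unfolding coeff_mat_def
      by (subst det_lower_triangular[of M]) (auto simp: prod_list_diag_mat degree_newton_poly intro!: coeff_eq_0)
    also have "\<dots> = 1"
      using monic_newton_poly[of b] by (simp add: degree_newton_poly)
    finally show ?thesis .
  qed
  finally show ?thesis by simp
qed

text \<open>Such row operations have determinant 1. They serve to replace multipliers
  \<open>X^r\<close> by monic polynomials of degree \<open>r\<close>.\<close>

lemma det_coeff_mat_unitriangular:
  fixes S S' :: "nat \<Rightarrow> 'a::idom poly"
  assumes lower: "\<And>r s. r < s \<Longrightarrow> s < M \<Longrightarrow> t r s = 0"
    and diag: "\<And>r. r < M \<Longrightarrow> t r r = 1"
    and comb: "\<And>r. r < M \<Longrightarrow> (\<Sum>s<M. smult (t r s) (S s)) = S' r"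
  shows "det (coeff_mat M S) = det (coeff_mat M S')"
proof -
  have "coeff_mat M S' = mat M M (\<lambda>(r, s). t r s) * coeff_mat M S"
    unfolding mat_mult_coeff_mat by (rule eq_matI) (auto simp: coeff_mat_def comb)
  then have "det (coeff_mat M S') = det (mat M M (\<lambda>(r, s). t r s)) * det (coeff_mat M S)"
    by (simp add: det_mult[of _ M])
  also have "det (mat M M (\<lambda>(r, s). t r s)) = 1"
    by (subst det_lower_triangular[of M]) (auto simp: prod_list_diag_mat lower diag)
  finally show ?thesis by simp
qed

section \<open>The discriminant as a determinant in the coefficients\<close>

text \<open>The Sylvester matrix of \<open>f\<close> and \<open>pderiv f\<close>, where \<open>pderiv f\<close> is formally given the degree
  \<open>degree f - 1\<close>, even if its actual degree is smaller (positive characteristic).\<close>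

definition deriv_rows :: "'a::idom poly \<Rightarrow> nat \<Rightarrow> 'a poly" where
  "deriv_rows f r = (if r < degree f then monom 1 r * pderiv f else monom 1 (r - degree f) * f)"

definition deriv_det :: "'a::idom poly \<Rightarrow> 'a" where
  "deriv_det f = det (coeff_mat (2 * degree f - 1) (deriv_rows f))"

lemma poly_eq_sum_monom_mult:
  fixes Q H :: "'a::comm_semiring_1 poly"
  assumes "degree Q < m"
  shows "(\<Sum>s<m. smult (coeff Q s) (monom 1 s * H)) = Q * H"
proof -
  have "(\<Sum>s<m. monom (coeff Q s) s) = Q"
    using poly_as_sum_of_monoms'[of Q "m - 1"] assms by (simp add: lessThan_Suc_atMost[symmetric])
  then have "Q * H = (\<Sum>s<m. monom (coeff Q s) s) * H" by simp
  also have "\<dots> = (\<Sum>s<m. smult (coeff Q s) (monom 1 s * H))"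
    unfolding sum_distrib_right by (rule sum.cong) (auto simp: smult_monom_mult)
  finally show ?thesis ..
qed

text \<open>Row operations turn the multipliers of \<open>pderiv f\<close> into Newton polynomials
  on the roots; the rows with \<open>f\<close> are Newton polynomials already. In the Newton basis
  the diagonal consists of the values of \<open>pderiv f\<close> at the roots, followed by
  ones.\<close>

lemma deriv_det_roots:
  fixes f :: "'a::idom poly"
  assumes f: "f = (\<Prod>a\<leftarrow>as. [:- a, 1:])"
  shows "deriv_det f = (\<Prod>a\<leftarrow>as. poly (pderiv f) a)"
proof -
  define m where "m = length as"
  \<comment> \<open>For \<open>m = 0\<close> truncated subtraction gives the empty matrix, whose
    determinant 1 matches the empty product.\<close>
  define M where "M = 2 * m - 1"
  have deg: "degree f = m"
    unfolding f m_def using degree_linear_factors[of uminus as] by simp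
  have f0: "f \<noteq> 0" unfolding f by (auto simp: prod_list_zero_iff)
  have deg': "degree (pderiv f) \<le> m - 1" using degree_pderiv_le[of f] deg by simp
  \<comment> \<open>Padding the roots with zeros makes the Newton polynomials from index
    \<open>m\<close> on equal to \<open>f\<close> times powers of \<open>X\<close>.\<close>
  define b where "b i = (if i < m then as ! i else 0)" for i
  define c where "c r = (if r < m then pderiv f else 1)" for r
  define t where "t r s = (if r < m then coeff (newton_poly b r) s else if r = s then 1 else 0)" for r s
  have newton_m: "newton_poly b m = f"
    unfolding f newton_poly_def prod.list_conv_set_nth
    by (auto simp: m_def b_def atLeast0LessThan intro!: prod.cong)
  have newton_ge: "newton_poly b (m + k) = monom 1 k * f" for k
  proof (induction k)
    case (Suc k)
    have "b (m + k) = 0" by (simp add: b_def)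
    with Suc show ?case by (simp add: newton_poly_Suc monom_Suc)
  qed (simp add: newton_m)
  have degc: "degree (newton_poly b r * c r) < M" if "r < M" for r
    using that deg' degree_mult_le[of "newton_poly b r" "c r"]
    by (auto simp: c_def degree_newton_poly M_def)
  have "deriv_det f = det (coeff_mat M (\<lambda>r. newton_poly b r * c r))"
    unfolding deriv_det_def deg M_def[symmetric]
  proof (rule det_coeff_mat_unitriangular[where t = t])
    fix r assume r: "r < M"
    show "t r r = 1"
      using monic_newton_poly[of b r] by (auto simp: t_def degree_newton_poly)
    show "(\<Sum>s<M. smult (t r s) (deriv_rows f s)) = newton_poly b r * c r"
    proof (cases "r < m")
      case True
      then have "m \<le> M" by (auto simp: M_def)
      then have "(\<Sum>s<M. smult (t r s) (deriv_rows f s))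
          = (\<Sum>s<m. smult (coeff (newton_poly b r) s) (monom 1 s * pderiv f))"
        using True
        by (intro sum.mono_neutral_cong_right)
           (auto simp: t_def deriv_rows_def deg degree_newton_poly coeff_eq_0)
      also have "\<dots> = newton_poly b r * pderiv f"
        using True by (intro poly_eq_sum_monom_mult) (simp add: degree_newton_poly)
      finally show ?thesis using True by (simp add: c_def)
    next
      case False
      have "(\<Sum>s<M. smult (t r s) (deriv_rows f s)) = (\<Sum>s<M. if r = s then deriv_rows f s else 0)"
        using False by (intro sum.cong) (auto simp: t_def)
      also have "\<dots> = newton_poly b r * c r"
        using False r newton_ge[of "r - m"] by (simp add: deriv_rows_def deg c_def)
      finally show ?thesis .
    qed
  qed (auto simp: t_def degree_newton_poly intro!: coeff_eq_0)
  also have "\<dots> = (\<Prod>r<M. poly (c r) (b r))"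
    by (rule det_coeff_mat_newton) (rule degc)
  also have "\<dots> = (\<Prod>r<m. poly (pderiv f) (as ! r))"
    by (rule prod.mono_neutral_cong_right) (auto simp: M_def c_def b_def)
  finally show ?thesis
    by (simp add: prod.list_conv_set_nth m_def atLeast0LessThan)
qed

section \<open>Congruences of determinants and the link to the discriminant\<close>

lemma dvd_prod_diff:
  fixes u :: "'a::comm_ring_1"
  assumes "\<And>i. i \<in> A \<Longrightarrow> u dvd x i - y i"
  shows "u dvd prod x A - prod y A"
  using assms
proof (induction A rule: infinite_finite_induct)
  case (insert i A)
  have "x i * prod x A - y i * prod y A = x i * (prod x A - prod y A) + (x i - y i) * prod y A"
    by (simp add: algebra_simps)
  then show ?case using insert by auto
qed auto

lemma dvd_det_diff:
  fixes A B :: "'a::comm_ring_1 mat"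
  assumes A: "A \<in> carrier_mat n n" and B: "B \<in> carrier_mat n n"
    and dvd: "\<And>i j. i < n \<Longrightarrow> j < n \<Longrightarrow> u dvd A $$ (i, j) - B $$ (i, j)"
  shows "u dvd det A - det B"
  unfolding det_def'[OF A] det_def'[OF B] sum_subtractf[symmetric] right_diff_distrib[symmetric]
  by (intro dvd_sum dvd_mult dvd_prod_diff dvd) (auto dest: permutes_in_image)

text \<open>Equal degrees give matrices of the same format, and the constant \<open>u\<close> passes
  through differentiation; so the matrices are congruent entrywise.\<close>

lemma dvd_deriv_det_diff:
  fixes f F :: "'a::idom poly"
  assumes u: "[:u:] dvd f - F" and deg: "degree F = degree f"
  shows "u dvd deriv_det f - deriv_det F"
proof -
  obtain q where q: "f - F = smult u q" using u by (auto simp: dvd_def)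
  have q': "pderiv f - pderiv F = smult u (pderiv q)"
    by (simp only: q pderiv_smult flip: pderiv_diff)
  have "deriv_rows f r - deriv_rows F r = smult u (if r < degree f then monom 1 r * pderiv q else monom 1 (r - degree f) * q)" for r
    by (simp add: deriv_rows_def deg q q' flip: right_diff_distrib mult_smult_right)
  then have "u dvd coeff (deriv_rows f r) i - coeff (deriv_rows F r) i" for r i
    by (metis coeff_diff coeff_smult dvd_triv_left)
  then show ?thesis unfolding deriv_det_def deg
    by (intro dvd_det_diff[of _ "2 * degree f - 1"]) (auto simp: coeff_mat_def)
qed

text \<open>Injectivity preserves \<open>degree f\<close>, hence the size of the matrix. This allows
  passing to an algebraic closure.\<close>

lemma (in inj_idom_hom) deriv_det_hom: "hom (deriv_det f) = deriv_det (map_poly hom f)"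
proof -
  interpret hp: map_poly_inj_idom_hom hom ..
  have "map_poly hom (deriv_rows f r) = deriv_rows (map_poly hom f) r" for r
    by (simp add: deriv_rows_def map_poly_pderiv hp.hom_mult)
  then have "map_mat hom (coeff_mat M (deriv_rows f)) = coeff_mat M (deriv_rows (map_poly hom f))" for M
    by (auto simp: coeff_mat_def simp flip: coeff_map_poly_hom)
  then show ?thesis by (simp add: deriv_det_def flip: hom_det)
qed

text \<open>Both are, up to sign, the product of the values of the derivative at the roots in an
  algebraic closure; injectivity brings this relation back to the domain.\<close>

lemma deriv_det_discriminant:
  fixes f :: "'a::idom poly"
  assumes f: "lead_coeff f = 1"
  shows "\<exists>s\<in>{1, -1}. deriv_det f = s * discriminant f"
proof -
  interpret h: inj_idom_hom "to_frac_ac :: 'a \<Rightarrow> _" by (rule to_frac_ac_hom)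
  obtain as where as: "map_poly to_frac_ac f = (\<Prod>a\<leftarrow>as. [:- a, 1:])"
    using discriminant_roots_exist[OF f] by blast
  obtain s where s: "s \<in> {1, -1}"
      "(\<Prod>a\<leftarrow>as. poly (pderiv (map_poly to_frac_ac f)) a) = s * disc_list as"
    using prod_pderiv_roots[of as] unfolding as by blast
  then have "to_frac_ac (deriv_det f) = s * to_frac_ac (discriminant f)"
    unfolding h.deriv_det_hom deriv_det_roots[OF as] to_frac_ac_discriminant[OF f as] disc_list_nth[symmetric]
    by simp
  then have "to_frac_ac (deriv_det f) = to_frac_ac (discriminant f)
      \<or> to_frac_ac (deriv_det f) = to_frac_ac (- discriminant f)"
    using s(1) by (auto simp: h.hom_uminus simp del: to_ac_eq_iff)
  then have "deriv_det f = discriminant f \<or> deriv_det f = - discriminant f"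
    by (simp only: h.eq_iff)
  then show ?thesis by auto
qed

section \<open>The rows of the generalised Sylvester matrix\<close>

text \<open>The pair \<open>(k, p)\<close> at position \<open>r\<close> labels row \<open>r\<close> of the generalised Sylvester matrix: it is the
  \<open>p\<close>-th row of the \<open>k\<close>-th block.\<close>

definition block_index :: "nat \<Rightarrow> (nat \<Rightarrow> nat) \<Rightarrow> (nat \<times> nat) list" where
  "block_index n m = concat (map (\<lambda>k. map (Pair k) [0..<m k]) [1..<Suc n])"

lemma set_block_index: "set (block_index n m) = (SIGMA k:{1..n}. {..<m k})"
  by (auto simp: block_index_def)

lemma length_block_index: "length (block_index n m) = (\<Sum>k=1..n. m k)"
proof -
  have "length (block_index n m) = sum_list (map m [1..<Suc n])"
    unfolding block_index_def by (simp add: length_concat o_def del: upt_Suc)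
  then show ?thesis
    by (simp only: interv_sum_list_conv_sum_set_nat atLeastLessThanSuc_atLeastAtMost set_upt)
qed

definition lex_less :: "nat \<times> nat \<Rightarrow> nat \<times> nat \<Rightarrow> bool" where
  "lex_less x y \<longleftrightarrow> fst x < fst y \<or> fst x = fst y \<and> snd x < snd y"

lemma sorted_block_index: "sorted_wrt lex_less (block_index n m)"
proof -
  have "sorted_wrt lex_less (concat (map (\<lambda>k. map (Pair k) [0..<m k]) ks))"
    if "sorted_wrt (<) ks" for ks
    using that
    by (induction ks) (auto simp: sorted_wrt_append sorted_wrt_map lex_less_def)
  then show ?thesis unfolding block_index_def by (simp del: upt_Suc)
qed

lemma block_index_less_iff:
  assumes "r < length (block_index n m)" "s < length (block_index n m)"
  shows "lex_less (block_index n m ! r) (block_index n m ! s) \<longleftrightarrow> r < s"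
proof (cases r s rule: linorder_cases)
  case less
  with sorted_wrt_nth_less[OF sorted_block_index less assms(2)] show ?thesis by simp
next
  case greater
  with sorted_wrt_nth_less[OF sorted_block_index greater assms(1)] show ?thesis
    by (auto simp: lex_less_def)
qed (simp add: lex_less_def)

lemma distinct_block_index: "distinct (block_index n m)"
  unfolding distinct_conv_nth
proof (intro allI impI)
  fix r s assume rs: "r < length (block_index n m)" "s < length (block_index n m)" "r \<noteq> s"
  then have "lex_less (block_index n m ! r) (block_index n m ! s)
      \<or> lex_less (block_index n m ! s) (block_index n m ! r)"
    using block_index_less_iff nat_neq_iff by blast
  then show "block_index n m ! r \<noteq> block_index n m ! s"
    by (metis lex_less_def less_irrefl)
qed

lemma bij_betw_block_index:
  "bij_betw ((!) (block_index n m)) {..<\<Sum>k=1..n. m k} (SIGMA k:{1..n}. {..<m k})"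
  using bij_betw_nth[OF distinct_block_index refl refl, of n m]
  by (simp add: length_block_index set_block_index)

text \<open>Positions follow the lexicographic order \<open>lex_less\<close>. The result determines
  which roots enter the Newton polynomial that belongs to row \<open>(k, p)\<close>.\<close>

lemma block_index_initial:
  assumes r: "r < (\<Sum>k=1..n. m k)" and kp: "block_index n m ! r = (k, p)"
  shows "bij_betw ((!) (block_index n m)) {..<r} ((SIGMA j:{1..<k}. {..<m j}) \<union> {k} \<times> {..<p})"
proof -
  let ?L = "block_index n m" and ?M = "\<Sum>k=1..n. m k"
  have mem: "k \<in> {1..n}" "p < m k"
    using bij_betwE[OF bij_betw_block_index[of n m]] r kp by force+
  have "(!) ?L ` {..<r} = {x \<in> (SIGMA k:{1..n}. {..<m k}). lex_less x (k, p)}"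
  proof (intro equalityI subsetI)
    fix x assume "x \<in> (!) ?L ` {..<r}"
    then obtain i where i: "i < r" "x = ?L ! i" by auto
    then have "x \<in> (SIGMA k:{1..n}. {..<m k})"
      using bij_betwE[OF bij_betw_block_index[of n m]] r by auto
    moreover have "lex_less x (k, p)"
      using i r kp block_index_less_iff[of i n m r] by (auto simp: length_block_index)
    ultimately show "x \<in> {x \<in> (SIGMA k:{1..n}. {..<m k}). lex_less x (k, p)}" by blast
  next
    fix x assume x: "x \<in> {x \<in> (SIGMA k:{1..n}. {..<m k}). lex_less x (k, p)}"
    then obtain i where i: "i < ?M" "x = ?L ! i"
      using bij_betw_imp_surj_on[OF bij_betw_block_index[of n m]] by (metis (no_types, lifting) imageE lessThan_iff mem_Collect_eq)
    then have "i < r"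
      using x r kp block_index_less_iff[of i n m r] by (auto simp: length_block_index)
    with i show "x \<in> (!) ?L ` {..<r}" by auto
  qed
  also have "\<dots> = (SIGMA j:{1..<k}. {..<m j}) \<union> {k} \<times> {..<p}"
    using mem by (auto simp: lex_less_def)
  finally show ?thesis
    using r bij_betw_block_index[of n m] unfolding bij_betw_def
    by (auto intro: inj_on_subset)
qed

text \<open>The shift by \<open>p\<close> is multiplication by \<open>monom 1 p\<close>; the entries
  outside the band are vanishing coefficients.\<close>

lemma Sylv_eq_coeff_mat:
  fixes g :: "nat \<Rightarrow> 'a::idom poly"
  shows "Sylv n g = coeff_mat (\<Sum>k=1..n. degree (g k))
    (\<lambda>r. case block_index n (\<lambda>k. degree (g k)) ! r of (k, p) \<Rightarrow> monom 1 p * (\<Prod>j\<in>{1..n} - {k}. g j))"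
proof -
  let ?L = "block_index n (\<lambda>k. degree (g k))" and ?M = "\<Sum>k=1..n. degree (g k)"
  let ?row = "\<lambda>(k, p). sylvester_row ?M (\<Prod>j\<in>{1..n} - {k}. g j) p"
  have "concat (map (\<lambda>k. map (sylvester_row ?M (\<Prod>j\<in>{1..n} - {k}. g j)) [0..<degree (g k)]) [1..<Suc n])
      = map ?row ?L"
    unfolding block_index_def by (simp add: map_concat o_def del: upt_Suc)
  then have S: "Sylv n g = mat_of_rows ?M (map ?row ?L)"
    by (simp add: Sylv_def Let_def)
  show ?thesis unfolding S
    by (rule eq_matI)
       (auto simp: coeff_mat_def length_block_index mat_of_rows_def sylvester_row_def coeff_monom_mult
          coeff_eq_0 split: prod.splits)
qed

section \<open>The generalised resultant in terms of roots\<close>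

text \<open>Replacing the powers of \<open>X\<close> in block \<open>k\<close> by the Newton polynomials of \<open>g k\<close> turns the rows into
  multiples of the Newton polynomials on the concatenated list of all roots.\<close>

lemma Res_roots:
  fixes g :: "nat \<Rightarrow> 'a::idom poly"
  assumes g: "\<And>k. k \<in> {1..n} \<Longrightarrow> g k = (\<Prod>a\<leftarrow>as k. [:- a, 1:])"
  shows "Res n g = (\<Prod>k=1..n. \<Prod>a\<leftarrow>as k. \<Prod>j\<in>{k<..n}. poly (g j) a)"
proof -
  define m where "m k = degree (g k)" for k
  define M where "M = (\<Sum>k=1..n. m k)"
  define L where "L = block_index n m"
  define H where "H k = (\<Prod>j\<in>{1..n} - {k}. g j)" for k
  define S where "S r = (case L ! r of (k, p) \<Rightarrow> monom 1 p * H k)" for r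
  define b where "b r = (case L ! r of (k, p) \<Rightarrow> as k ! p)" for r
  \<comment> \<open>In row \<open>(k, p)\<close> the factors \<open>g j\<close> of
    \<open>H k\<close> with \<open>j < k\<close> are absorbed by \<open>newton_poly b r\<close>;
    those with \<open>k < j\<close> remain.\<close>
  define c where "c r = (\<Prod>j\<in>{fst (L ! r)<..n}. g j)" for r
  define N where "N k = newton_poly ((!) (as k))" for k
  \<comment> \<open>Acts within each block; lower unitriangular because \<open>N k p\<close> is
    monic of degree \<open>p\<close>.\<close>
  define t where "t r s = (if fst (L ! r) = fst (L ! s) then coeff (N (fst (L ! r)) (snd (L ! r))) (snd (L ! s)) else 0)" for r s
  have len: "length (as k) = m k" if "k \<in> {1..n}" for k
    using degree_linear_factors[of uminus "as k"] g[OF that] by (simp add: m_def)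
  have g0: "g k \<noteq> 0" if "k \<in> {1..n}" for k
    unfolding g[OF that] by (auto simp: prod_list_zero_iff)
  have Nm: "N k (m k) = g k" if "k \<in> {1..n}" for k
    unfolding g[OF that] N_def newton_poly_def prod.list_conv_set_nth
    by (simp add: len[OF that] atLeast0LessThan)
  have degN: "degree (N k p) = p" for k p by (simp add: N_def degree_newton_poly)
  have bij: "bij_betw ((!) L) {..<M} (SIGMA k:{1..n}. {..<m k})"
    unfolding L_def M_def by (rule bij_betw_block_index)
  have L_cases: "\<exists>k p. L ! r = (k, p) \<and> k \<in> {1..n} \<and> p < m k" if "r < M" for r
    using bij_betwE[OF bij] that by force
  have L_less: "lex_less (L ! r) (L ! s)" if "r < s" "s < M" for r s
    using that block_index_less_iff[of r n m s] by (simp add: L_def M_def length_block_index)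
  have newton: "newton_poly b r = (\<Prod>j\<in>{1..<k}. g j) * N k p" if r: "r < M" and kp: "L ! r = (k, p)" for r k p
  proof -
    have k: "k \<in> {1..n}" using L_cases[OF r] kp by auto
    let ?F = "\<lambda>(j, i). [:- (as j ! i), 1:]"
    have "newton_poly b r = (\<Prod>i<r. ?F (L ! i))"
      unfolding newton_poly_def b_def by (auto simp: case_prod_unfold)
    also have "\<dots> = prod ?F ((SIGMA j:{1..<k}. {..<m j}) \<union> {k} \<times> {..<p})"
      using block_index_initial[of r m n k p] r kp
      by (intro prod.reindex_bij_betw) (simp add: L_def M_def)
    also have "\<dots> = prod ?F (SIGMA j:{1..<k}. {..<m j}) * prod ?F ({k} \<times> {..<p})"
      by (rule prod.union_disjoint) auto
    also have "prod ?F (SIGMA j:{1..<k}. {..<m j}) = (\<Prod>j\<in>{1..<k}. N j (m j))"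
      by (subst prod.Sigma[symmetric]) (auto simp: N_def newton_poly_def)
    also have "\<dots> = (\<Prod>j\<in>{1..<k}. g j)" using k by (intro prod.cong) (auto simp: Nm)
    also have "prod ?F ({k} \<times> {..<p}) = N k p"
      by (subst prod.Sigma[symmetric]) (auto simp: N_def newton_poly_def)
    finally show ?thesis .
  qed
  have split_H: "H k = (\<Prod>j\<in>{1..<k}. g j) * (\<Prod>j\<in>{k<..n}. g j)" if "k \<in> {1..n}" for k
  proof -
    have *: "{1..n} - {k} = {1..<k} \<union> {k<..n}" using that by auto
    show ?thesis unfolding H_def * by (rule prod.union_disjoint) auto
  qed
  have nc: "newton_poly b r * c r = N k p * H k" if r: "r < M" and kp: "L ! r = (k, p)" for r k p
    using newton[OF that] L_cases[OF r] kp split_H[of k] by (auto simp: c_def mult_ac)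
  have degH: "degree (H k) + m k = M" if "k \<in> {1..n}" for k
  proof -
    have "degree (H k) = (\<Sum>j\<in>{1..n} - {k}. m j)"
      unfolding H_def m_def using g0 by (intro degree_prod_eq_sum_degree) auto
    then show ?thesis using that by (simp add: M_def sum.remove)
  qed
  have degc: "degree (newton_poly b r * c r) < M" if r: "r < M" for r
  proof -
    obtain k p where kp: "L ! r = (k, p)" "k \<in> {1..n}" "p < m k" using L_cases[OF r] by blast
    have "degree (newton_poly b r * c r) \<le> p + degree (H k)"
      unfolding nc[OF r kp(1)] using degree_mult_le[of "N k p" "H k"] by (simp add: degN)
    then show ?thesis using kp degH[of k] by linarith
  qed
  have "Res n g = det (coeff_mat M S)"
    unfolding Res_def Sylv_eq_coeff_mat S_def L_def M_def H_def m_def ..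
  also have "\<dots> = det (coeff_mat M (\<lambda>r. newton_poly b r * c r))"
  proof (rule det_coeff_mat_unitriangular[where t = t])
    fix r s assume "r < s" "s < M"
    then show "t r s = 0" using L_less[of r s]
      by (auto simp: t_def lex_less_def degN intro!: coeff_eq_0)
  next
    fix r assume r: "r < M"
    obtain k p where kp: "L ! r = (k, p)" "k \<in> {1..n}" "p < m k" using L_cases[OF r] by blast
    show "t r r = 1"
      using monic_newton_poly[of "(!) (as k)" p] by (simp add: t_def kp N_def degree_newton_poly)
    let ?F = "\<lambda>(j, i). smult (if k = j then coeff (N k p) i else 0) (monom 1 i * H j)"
    have "(\<Sum>s<M. smult (t r s) (S s)) = (\<Sum>s<M. ?F (L ! s))"
      by (intro sum.cong refl) (auto simp: t_def S_def kp split: prod.splits)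
    also have "\<dots> = sum ?F (SIGMA k:{1..n}. {..<m k})"
      by (rule sum.reindex_bij_betw[OF bij])
    also have "\<dots> = (\<Sum>j=1..n. \<Sum>i<m j. ?F (j, i))"
      by (subst sum.Sigma) auto
    also have "\<dots> = (\<Sum>j=1..n. if k = j then (\<Sum>i<m k. smult (coeff (N k p) i) (monom 1 i * H k)) else 0)"
      by (intro sum.cong) auto
    also have "\<dots> = (\<Sum>i<m k. smult (coeff (N k p) i) (monom 1 i * H k))"
      using kp by simp
    also have "\<dots> = N k p * H k"
      using kp by (intro poly_eq_sum_monom_mult) (simp add: degN)
    finally show "(\<Sum>s<M. smult (t r s) (S s)) = newton_poly b r * c r"
      using nc[OF r kp(1)] by simp
  qed
  also have "\<dots> = (\<Prod>r<M. poly (c r) (b r))"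
    by (rule det_coeff_mat_newton) (rule degc)
  also have "\<dots> = (\<Prod>r<M. (\<lambda>(k, p). \<Prod>j\<in>{k<..n}. poly (g j) (as k ! p)) (L ! r))"
    by (intro prod.cong refl) (auto simp: c_def b_def poly_prod split: prod.splits)
  also have "\<dots> = (\<Prod>(k, p)\<in>(SIGMA k:{1..n}. {..<m k}). \<Prod>j\<in>{k<..n}. poly (g j) (as k ! p))"
    by (rule prod.reindex_bij_betw[OF bij])
  also have "\<dots> = (\<Prod>k=1..n. \<Prod>p<m k. \<Prod>j\<in>{k<..n}. poly (g j) (as k ! p))"
    by (subst prod.Sigma) auto
  also have "\<dots> = (\<Prod>k=1..n. \<Prod>a\<leftarrow>as k. \<Prod>j\<in>{k<..n}. poly (g j) a)"
    by (intro prod.cong refl) (simp add: prod.list_conv_set_nth len atLeast0LessThan)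
  finally show ?thesis .
qed

lemma (in inj_idom_hom) Res_hom: "hom (Res n g) = Res n (\<lambda>k. map_poly hom (g k))"
proof -
  interpret hp: map_poly_inj_idom_hom hom ..
  show ?thesis
    unfolding Res_def Sylv_eq_coeff_mat hom_det[symmetric]
    by (rule arg_cong[of _ _ det], rule eq_matI)
       (auto simp: coeff_mat_def hp.hom_prod hp.hom_mult simp flip: coeff_map_poly_hom split: prod.splits)
qed

section \<open>The discriminant of a product\<close>

lemma prod_list_map_mult:
  fixes f g :: "'a \<Rightarrow> 'b::comm_monoid_mult"
  shows "(\<Prod>x\<leftarrow>xs. f x * g x) = (\<Prod>x\<leftarrow>xs. f x) * (\<Prod>x\<leftarrow>xs. g x)"
  by (induction xs) (auto simp: mult_ac)

lemma prod_list_map_concat: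
  fixes f :: "'a \<Rightarrow> 'b::comm_monoid_mult"
  shows "(\<Prod>x\<leftarrow>concat (map as [1..<Suc n]). f x) = (\<Prod>k=1..n. \<Prod>x\<leftarrow>as k. f x)"
  by (induction n) auto

lemma disc_list_append:
  "disc_list (xs @ ys) = disc_list xs * (\<Prod>x\<leftarrow>xs. (\<Prod>y\<leftarrow>ys. x - y)\<^sup>2) * disc_list ys"
proof (induction xs)
  case (Cons x xs)
  have "(\<Prod>y\<leftarrow>zs. (x - y)\<^sup>2) = (\<Prod>y\<leftarrow>zs. x - y)\<^sup>2" for zs
    by (induction zs) (auto simp: power_mult_distrib)
  with Cons show ?case by (simp add: mult_ac)
qed simp

lemma prod_list_power2:
  fixes f :: "'a \<Rightarrow> 'b::comm_monoid_mult"
  shows "(\<Prod>x\<leftarrow>xs. (f x)\<^sup>2) = (\<Prod>x\<leftarrow>xs. f x)\<^sup>2"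
  by (induction xs) (auto simp: power_mult_distrib)

text \<open>Induction on the number of blocks: a new block contributes its own
  \<open>disc_list\<close> and the squared differences with all earlier roots, which multiply to
  squared values of the new polynomial. By \<open>Res_roots\<close>, the product being squared is
  the resultant.\<close>

lemma disc_list_concat:
  fixes g :: "nat \<Rightarrow> 'a::idom poly"
  assumes "\<And>k. k \<in> {1..n} \<Longrightarrow> g k = (\<Prod>a\<leftarrow>as k. [:- a, 1:])"
  shows "disc_list (concat (map as [1..<Suc n]))
    = (\<Prod>k=1..n. \<Prod>a\<leftarrow>as k. \<Prod>j\<in>{k<..n}. poly (g j) a)\<^sup>2 * (\<Prod>k=1..n. disc_list (as k))"
  using assms
proof (induction n)
  case (Suc n)
  have eval: "poly (g (Suc n)) x = (\<Prod>y\<leftarrow>as (Suc n). x - y)" for x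
    by (simp add: Suc.prems poly_prod_list o_def)
  have "(\<Prod>a\<leftarrow>as k. \<Prod>j\<in>{k<..Suc n}. poly (g j) a)
      = (\<Prod>a\<leftarrow>as k. poly (g (Suc n)) a) * (\<Prod>a\<leftarrow>as k. \<Prod>j\<in>{k<..n}. poly (g j) a)" if "k \<in> {1..n}" for k
  proof -
    have "{k<..Suc n} = insert (Suc n) {k<..n}" using that by auto
    then show ?thesis by (simp add: prod_list_map_mult)
  qed
  \<comment> \<open>For \<open>k = Suc n\<close> the range \<open>{k<..Suc n}\<close> is empty, and
    the factor is a product of ones.\<close>
  moreover have ones: "(\<Prod>x\<leftarrow>xs. 1) = (1::'a)" for xs :: "'a list"
    by (induction xs) auto
  ultimately have cross: "(\<Prod>k=1..Suc n. \<Prod>a\<leftarrow>as k. \<Prod>j\<in>{k<..Suc n}. poly (g j) a)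
      = (\<Prod>k=1..n. \<Prod>a\<leftarrow>as k. poly (g (Suc n)) a)
        * (\<Prod>k=1..n. \<Prod>a\<leftarrow>as k. \<Prod>j\<in>{k<..n}. poly (g j) a)"
    by (simp add: prod.distrib ones cong: prod.cong_simp)
  have split: "concat (map as [1..<Suc (Suc n)]) = concat (map as [1..<Suc n]) @ as (Suc n)"
    by simp
  have "disc_list (concat (map as [1..<Suc (Suc n)]))
      = disc_list (concat (map as [1..<Suc n]))
        * (\<Prod>x\<leftarrow>concat (map as [1..<Suc n]). poly (g (Suc n)) x)\<^sup>2 * disc_list (as (Suc n))"
    by (simp only: split disc_list_append eval prod_list_power2)
  also have "\<dots> = (\<Prod>k=1..Suc n. \<Prod>a\<leftarrow>as k. \<Prod>j\<in>{k<..Suc n}. poly (g j) a)\<^sup>2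
      * (\<Prod>k=1..Suc n. disc_list (as k))"
    unfolding prod_list_map_concat cross using Suc
    by (simp add: power_mult_distrib mult_ac del: upt_Suc)
  finally show ?case .
qed simp

text \<open>In an algebraic closure, \<open>disc_list_concat\<close> splits the list of all roots
  and \<open>Res_roots\<close> identifies the mixed part; injectivity pulls the identity
  back.\<close>

lemma discriminant_prod:
  fixes g :: "nat \<Rightarrow> 'a::idom poly"
  assumes monic: "\<And>k. k \<in> {1..n} \<Longrightarrow> lead_coeff (g k) = 1"
  shows "discriminant (\<Prod>k=1..n. g k) = (Res n g)\<^sup>2 * (\<Prod>k=1..n. discriminant (g k))"
proof -
  interpret h: inj_idom_hom "to_frac_ac :: 'a \<Rightarrow> _" by (rule to_frac_ac_hom)
  interpret hp: map_poly_inj_idom_hom "to_frac_ac :: 'a \<Rightarrow> _" ..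
  let ?h = "to_frac_ac :: 'a \<Rightarrow> _"
  have "\<forall>k\<in>{1..n}. \<exists>as. map_poly ?h (g k) = (\<Prod>a\<leftarrow>as. [:- a, 1:])"
    using discriminant_roots_exist[OF monic] by metis
  then obtain as where as: "\<And>k. k \<in> {1..n} \<Longrightarrow> map_poly ?h (g k) = (\<Prod>a\<leftarrow>as k. [:- a, 1:])"
    by metis
  have "lead_coeff (\<Prod>k=1..n. g k) = 1"
    by (simp add: lead_coeff_prod monic)
  moreover have "map_poly ?h (\<Prod>k=1..n. g k) = (\<Prod>a\<leftarrow>concat (map as [1..<Suc n]). [:- a, 1:])"
    unfolding hp.hom_prod prod_list_map_concat by (intro prod.cong refl as)
  ultimately have "?h (discriminant (\<Prod>k=1..n. g k)) = disc_list (concat (map as [1..<Suc n]))"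
    unfolding disc_list_nth by (rule to_frac_ac_discriminant)
  also have "\<dots> = (Res n (\<lambda>k. map_poly ?h (g k)))\<^sup>2 * (\<Prod>k=1..n. disc_list (as k))"
    using disc_list_concat[of n "\<lambda>k. map_poly ?h (g k)" as, OF as]
      Res_roots[of n "\<lambda>k. map_poly ?h (g k)" as, OF as] by metis
  also have "(\<Prod>k=1..n. disc_list (as k)) = (\<Prod>k=1..n. ?h (discriminant (g k)))"
    unfolding disc_list_nth
    by (intro prod.cong refl to_frac_ac_discriminant[symmetric] as monic)
  also have "(Res n (\<lambda>k. map_poly ?h (g k)))\<^sup>2 * \<dots> = ?h ((Res n g)\<^sup>2 * (\<Prod>k=1..n. discriminant (g k)))"
    by (simp only: h.Res_hom h.hom_mult h.hom_power h.hom_prod)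
  finally show ?thesis by (simp only: h.eq_iff)
qed

section \<open>Divisibility by the prime element and the conclusion\<close>

text \<open>Were the degrees different, the leading coefficient of the longer polynomial would
  survive up to sign in the difference, and the nonunit \<open>u\<close> would divide 1.\<close>

lemma degree_eq_of_monic_diff:
  fixes f G :: "'a::idom poly"
  assumes f: "lead_coeff f = 1" and G: "lead_coeff G = 1"
    and u: "[:u:] dvd f - G" "\<not> u dvd 1"
  shows "degree f = degree G"
proof (rule ccontr)
  assume "degree f \<noteq> degree G"
  then have "coeff (f - G) (max (degree f) (degree G)) \<in> {1, -1}"
    using f G by (auto simp: max_def coeff_eq_0)
  moreover have "u dvd coeff (f - G) i" for i
    using u(1) by (simp add: const_poly_dvd_iff)
  ultimately show False using u(2) by (metis dvd_minus_iff insertE singletonD)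
qed

text \<open>One factor at a time: primality puts \<open>\<pi>\<close> into \<open>x\<close>, and the
  domain allows cancelling it.\<close>

lemma prime_elem_power_dvd_mult_cancel:
  fixes \<pi> :: "'a::idom"
  assumes "prime_elem \<pi>" "\<not> \<pi> dvd w" "\<pi> ^ i dvd x * w"
  shows "\<pi> ^ i dvd x"
  using assms(3)
proof (induction i arbitrary: x)
  case (Suc i)
  from Suc.prems have "\<pi> dvd x * w" by (metis dvd_mult_left power_Suc)
  then have "\<pi> dvd x" using assms(1,2) prime_elem_dvd_mult_iff by blast
  then obtain y where y: "x = \<pi> * y" by (auto elim: dvdE)
  have "\<pi> \<noteq> 0" using assms(1) by auto
  with Suc.prems have "\<pi> ^ i dvd y * w" by (simp add: y mult.assoc)
  then have "\<pi> ^ i dvd y" by (rule Suc.IH)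
  then show ?case by (simp add: y)
qed simp

text \<open>If the right side is a finite \<open>N\<close>, every \<open>i\<close> with
  \<open>\<pi> ^ i dvd x\<close> is at most \<open>N div 2\<close>, so the supremum on the left is
  finite too.\<close>

lemma double_valuation_le:
  assumes "\<And>i. \<pi> ^ i dvd x \<Longrightarrow> \<pi> ^ (2 * i) dvd y"
  shows "2 * valuation \<pi> x \<le> valuation \<pi> y"
proof (cases "valuation \<pi> y")
  case (enat N)
  have "enat (2 * i) \<le> enat N" if "\<pi> ^ i dvd x" for i
    using assms[OF that] unfolding enat[symmetric] valuation_def by (intro SUP_upper) auto
  then have "valuation \<pi> x \<le> enat (N div 2)"
    unfolding valuation_def by (intro SUP_least) force
  then have "2 * valuation \<pi> x \<le> 2 * enat (N div 2)" by (rule mult_left_mono) simp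
  also have "\<dots> \<le> enat N" by (simp add: numeral_eq_enat)
  finally show ?thesis by (simp add: enat)
qed simp

theorem proposition9:
  fixes \<pi> :: "'a::idom" and n :: nat and g :: "nat \<Rightarrow> 'a poly" and f :: "'a poly"
  assumes "prime_elem \<pi>"
    and "n \<ge> 1"
    and "\<And>k. k \<in> {1..n} \<Longrightarrow> lead_coeff (g k) = 1 \<and> degree (g k) \<ge> 1"
    and "lead_coeff f = 1"
    and "discriminant f \<noteq> 0"
    and "[:\<pi> * discriminant f:] dvd f - (\<Prod>k=1..n. g k)"
  shows "Res n g \<noteq> 0 \<and> 2 * valuation \<pi> (Res n g) \<le> valuation \<pi> (discriminant f)"
proof -
  define G where "G = (\<Prod>k=1..n. g k)"
  note dvd = assms(6)[folded G_def]
  have G: "lead_coeff G = 1" using assms(3) by (simp add: G_def lead_coeff_prod)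
  have Res_dvd: "(Res n g)\<^sup>2 dvd discriminant G"
    using discriminant_prod[of n g] assms(3) by (auto simp: G_def)
  have not_unit: "\<not> \<pi> dvd 1" using assms(1) by (rule prime_elem_not_unit)
  then have "degree f = degree G"
    using degree_eq_of_monic_diff[OF assms(4) G dvd] by (auto dest: dvd_mult_left)
  then have "\<pi> * discriminant f dvd deriv_det f - deriv_det G"
    by (intro dvd_deriv_det_diff[OF dvd]) simp
  then obtain d where d: "deriv_det f - deriv_det G = \<pi> * discriminant f * d" by (auto elim: dvdE)
  obtain s s' where s: "s \<in> {1, -1}" "deriv_det f = s * discriminant f"
      "s' \<in> {1, -1}" "deriv_det G = s' * discriminant G"
    using deriv_det_discriminant[OF assms(4)] deriv_det_discriminant[OF G] by blast
  \<comment> \<open>Chosen so that \<open>discriminant G = discriminant f * w\<close>, using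
    \<open>s' * s' = 1\<close>; modulo \<open>\<pi>\<close> it is a sign.\<close>
  define w where "w = s' * s - \<pi> * (s' * d)"
  have "discriminant G = s' * deriv_det G" using s(3,4) by auto
  also have "deriv_det G = s * discriminant f - \<pi> * discriminant f * d"
    using d s(2) by (simp add: algebra_simps)
  also have "s' * \<dots> = discriminant f * w" by (simp add: w_def algebra_simps)
  finally have w: "discriminant G = discriminant f * w" .
  have ndvd: "\<not> \<pi> dvd w"
  proof
    assume "\<pi> dvd w"
    then have "\<pi> dvd w + \<pi> * (s' * d)" by simp
    then have "\<pi> dvd s' * s" by (simp add: w_def)
    then show False using s(1,3) not_unit by auto
  qed
  then have "w \<noteq> 0" by auto
  \<comment> \<open>Otherwise \<open>discriminant G\<close>, a multiple of the squared resultant,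
    would vanish, although both \<open>discriminant f\<close> and \<open>w\<close> are
    nonzero.\<close>
  then have "Res n g \<noteq> 0" using Res_dvd w assms(5) by auto
  moreover have "2 * valuation \<pi> (Res n g) \<le> valuation \<pi> (discriminant f)"
  proof (rule double_valuation_le)
    fix i assume "\<pi> ^ i dvd Res n g"
    then have "\<pi> ^ (2 * i) dvd (Res n g)\<^sup>2"
      by (metis dvd_power_same mult.commute power_mult)
    then have "\<pi> ^ (2 * i) dvd discriminant f * w" using Res_dvd w by (metis dvd_trans)
    then show "\<pi> ^ (2 * i) dvd discriminant f"
      using prime_elem_power_dvd_mult_cancel[OF assms(1) ndvd] by blast
  qed
  ultimately show ?thesis ..
qed

end
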